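(* Let $a,b,c,d\in\mathbb{N}$. If $a+b+c+d$ is odd, then $\zeta_2((a,b,c,d);PSp(2))$ can be expressed as a polynomial in $\{\zeta(j+1)\,:\,j\in\mathbb{N}\}$ with $\mathbb{Q}$-coefficients.
   Context: $\zeta_2((s_1,s_2,s_3,s_4);PSp(2))=\sum_{m_1,m_2\ge1,\ m_1\equiv1\ (\mathrm{mod}\ 2)}\frac{1}{m_1^{s_1}m_2^{s_2}(m_1+m_2)^{s_3}(m_1+2m_2)^{s_4}}$; $\zeta$ is the Riemann zeta-function. *)

theory Defs
  imports "HOL-Analysis.Analysis" "HOL-Library.Poly_Mapping" "HOL-Number_Theory.Cong"
begin

text \<open>The Dirichlet series of the Riemann zeta function, valid for \<open>Re s > 1\<close>. No analytic
  continuation is built in: outside this half-plane the value is meaningless.\<close>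

definition riemann_zeta :: "complex \<Rightarrow> complex" where
  "riemann_zeta s = suminf (\<lambda>n. 1 / of_nat (Suc n) powr s)"

definition zeta2_PSp2 :: "complex \<Rightarrow> complex \<Rightarrow> complex \<Rightarrow> complex \<Rightarrow> complex" where
  "zeta2_PSp2 s1 s2 s3 s4 =
     (\<Sum>\<^sub>\<infinity>(m1, m2) \<in> {(m1 :: nat, m2 :: nat). m1 \<ge> 1 \<and> m2 \<ge> 1 \<and> [m1 = 1] (mod 2)}.
        1 / (of_nat m1 powr s1 * of_nat m2 powr s2 *
             of_nat (m1 + m2) powr s3 * of_nat (m1 + 2 * m2) powr s4))"

text \<open>A polynomial with rational coefficients in countably many variables \<open>X j\<close> is a finitely
  supported map from monomials to coefficients, a monomial being a finitely supported map from
  variable indices to exponents.\<close>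

type_synonym rat_mpoly = "(nat \<Rightarrow>\<^sub>0 nat) \<Rightarrow>\<^sub>0 rat"

definition mpoly_vars :: "rat_mpoly \<Rightarrow> nat set" where
  "mpoly_vars p = (\<Union>m \<in> Poly_Mapping.keys p. Poly_Mapping.keys m)"

definition mpoly_eval :: "(nat \<Rightarrow> complex) \<Rightarrow> rat_mpoly \<Rightarrow> complex" where
  "mpoly_eval x p =
     (\<Sum>m \<in> Poly_Mapping.keys p. of_rat (Poly_Mapping.lookup p m) *
        (\<Prod>j \<in> Poly_Mapping.keys m. x j ^ Poly_Mapping.lookup m j))"

text \<open>Since an infinite sum over a non-summable family is 0 by convention, we record that the
  family is summable for positive integer exponents.\<close>

lemma zeta2_PSp2_summable:
  fixes a b c d :: nat
  assumes "a \<ge> 1" "b \<ge> 1" "c \<ge> 1" "d \<ge> 1"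
  shows "(\<lambda>(m1, m2). 1 / (of_nat m1 powr of_nat a * of_nat m2 powr of_nat b *
             of_nat (m1 + m2) powr of_nat c * of_nat (m1 + 2 * m2) powr of_nat d) :: complex)
         summable_on {(m1 :: nat, m2 :: nat). m1 \<ge> 1 \<and> m2 \<ge> 1 \<and> [m1 = 1] (mod 2)}"
    (is "?f summable_on ?A")
proof -
  let ?g = "\<lambda>m::nat. 1 / real m ^ 2"
  have g: "?g summable_on UNIV"
    by (intro norm_summable_imp_summable_on) (use inverse_power_summable[of 2, where 'a=real] in
        \<open>simp add: divide_inverse\<close>)
  have "(\<lambda>(m, n). ?g m * ?g n) summable_on (UNIV \<times> UNIV)"
  proof (rule summable_on_SigmaI)
    show "((\<lambda>n. case (m, n) of (m, n) \<Rightarrow> ?g m * ?g n) has_sum ?g m * infsum ?g UNIV) UNIV" for m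
      using has_sum_cmult_right[OF has_sum_infsum[OF g], of "?g m"] by simp
    show "(\<lambda>m. ?g m * infsum ?g UNIV) summable_on UNIV"
      by (rule summable_on_cmult_left[OF g])
  qed auto
  hence "(\<lambda>(m, n). ?g m * ?g n) summable_on ?A"
    by (rule summable_on_subset_banach) auto
  hence "(\<lambda>x. norm (?f x)) summable_on ?A"
  proof (rule summable_on_comparison_test)
    fix x assume "x \<in> ?A"
    then obtain m n where x: "x = (m, n)" and m: "m \<ge> 1" and n: "n \<ge> 1" by auto
    have P: "real k \<le> real k ^ e" if "k \<ge> 1" "e \<ge> 1" for k e :: nat
      using that power_increasing[of 1 e "real k"] by simp
    have "real m * real n * real m * real n \<le>
            real m ^ a * real n ^ b * real (m + n) ^ c * real (m + 2 * n) ^ d"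
    proof (intro mult_mono)
      show "real m \<le> real (m + n) ^ c" using P[of "m + n" c] m assms by simp
      show "real n \<le> real (m + 2 * n) ^ d" using P[of "m + 2 * n" d] n assms by simp
    qed (use P m n assms in auto)
    moreover have "norm (?f x) =
       1 / (real m ^ a * real n ^ b * real (m + n) ^ c * real (m + 2 * n) ^ d)"
      using m n by (simp add: x powr_nat' norm_divide norm_mult norm_power del: of_nat_add of_nat_mult)
    moreover have "0 < real m * real n * real m * real n" using m n by simp
    ultimately show "norm (?f x) \<le> (case x of (m, n) \<Rightarrow> ?g m * ?g n)"
      by (simp add: x power2_eq_square frac_le mult_ac)
  qed auto
  thus ?thesis by (rule abs_summable_summable)
qed

end

theory Submission
  imports Defs "HOL-Computational_Algebra.Polynomial"
begin

text \<open>Write \<open>Z(a,b,c,d)\<close> for the zeta value. In the coordinates \<open>x = m1\<close>, \<open>t = m1 + 2 m2\<close> the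
  summand is, up to a power of 2, \<open>x\<^sup>-\<^sup>a (t-x)\<^sup>-\<^sup>b (t+x)\<^sup>-\<^sup>c t\<^sup>-\<^sup>d\<close> with \<open>0 < x < t\<close> both odd. Summing over
  all odd integers \<open>x\<close> off the poles, the four intervals cut out by \<open>0\<close> and \<open>\<plusminus>t\<close> contribute
  \<open>Z(a,b,c,d) + (-1)\<^sup>a Z(a,c,b,d) + (-1)\<^sup>b Z(d,b,c,a) + (-1)\<^sup>a\<^sup>+\<^sup>c Z(d,c,b,a)\<close>. In the coordinates
  \<open>y = m2\<close>, \<open>z = m1 + m2\<close>, which have opposite parity, summing over all \<open>y\<close> gives the same four
  terms except that the last sign is \<open>(-1)\<^sup>b\<^sup>+\<^sup>d\<close>. When \<open>a + b + c + d\<close> is odd the difference of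
  the two is \<open>\<plusminus>2 Z(d,c,b,a)\<close>.

  Each full sum lies in the algebra of zeta values: partial fractions turn the inner sum over a
  residue class modulo 2 into a polynomial in \<open>1/t\<close> whose coefficients are rational combinations of
  1 and even zeta values, and since this polynomial has no constant term, the outer sum only
  involves \<open>\<zeta>(n)\<close> with \<open>n \<ge> 2\<close>. Partial fractions produce terms of degree 1, so the inner sum is
  taken as the limit of the sums over \<open>{-N..N}\<close>.\<close>

section \<open>The algebra generated by the zeta values\<close>

definition monomial_eval :: "(nat \<Rightarrow> complex) \<Rightarrow> (nat \<Rightarrow>\<^sub>0 nat) \<Rightarrow> complex" where
  "monomial_eval x m = (\<Prod>j \<in> Poly_Mapping.keys m. x j ^ Poly_Mapping.lookup m j)"

text \<open>Variables outside the support contribute \<open>x j ^ 0 = 1\<close>, so products over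
  different supports can be compared over a common finite index set.\<close>

lemma monomial_eval_superset:
  assumes "finite A" "Poly_Mapping.keys m \<subseteq> A"
  shows "monomial_eval x m = (\<Prod>j\<in>A. x j ^ Poly_Mapping.lookup m j)"
  unfolding monomial_eval_def
  by (rule prod.mono_neutral_left) (use assms in \<open>auto simp: in_keys_iff\<close>)

lemma monomial_eval_add: "monomial_eval x (m + n) = monomial_eval x m * monomial_eval x n"
proof -
  let ?A = "Poly_Mapping.keys m \<union> Poly_Mapping.keys n"
  have A: "finite ?A" "Poly_Mapping.keys (m + n) \<subseteq> ?A" by (simp_all add: keys_add)
  show ?thesis
    by (simp add: monomial_eval_superset[OF A] monomial_eval_superset[of ?A m]
        monomial_eval_superset[of ?A n] lookup_add power_add prod.distrib)
qed

lemma mpoly_eval_superset: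
  assumes "finite A" "Poly_Mapping.keys p \<subseteq> A"
  shows "mpoly_eval x p = (\<Sum>m\<in>A. of_rat (Poly_Mapping.lookup p m) * monomial_eval x m)"
  unfolding mpoly_eval_def monomial_eval_def
  by (rule sum.mono_neutral_left) (use assms in \<open>auto simp: in_keys_iff\<close>)

lemma mpoly_eval_add: "mpoly_eval x (p + q) = mpoly_eval x p + mpoly_eval x q"
proof -
  let ?A = "Poly_Mapping.keys p \<union> Poly_Mapping.keys q"
  have A: "finite ?A" "Poly_Mapping.keys (p + q) \<subseteq> ?A" by (simp_all add: keys_add)
  show ?thesis
    by (simp add: mpoly_eval_superset[OF A] mpoly_eval_superset[of ?A p]
        mpoly_eval_superset[of ?A q] lookup_add of_rat_add sum.distrib ring_distribs)
qed

lemma mpoly_eval_single: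
  "mpoly_eval x (Poly_Mapping.single m c) = of_rat c * monomial_eval x m"
  by (subst mpoly_eval_superset[of "{m}"]) auto

lemma mpoly_eval_0: "mpoly_eval x 0 = 0"
  by (simp add: mpoly_eval_def)

lemma mpoly_induct [case_names zero add_single]:
  fixes p :: rat_mpoly
  assumes "P 0" and "\<And>q m c. P q \<Longrightarrow> P (Poly_Mapping.single m c + q)"
  shows "P p"
proof (induction p rule: update_induct)
  case const
  show ?case by fact
next
  case (update f m c)
  \<comment> \<open>\<open>m\<close> is not yet a key of \<open>f\<close>, so overwriting its
    coefficient amounts to adding a single term.\<close>
  have "Poly_Mapping.update m c f = Poly_Mapping.single m c + f"
    by (rule poly_mapping_eqI)
       (use update in \<open>auto simp: lookup_update lookup_add lookup_single in_keys_iff when_def\<close>)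
  thus ?case using assms(2) update by simp
qed

text \<open>Both sides are additive in each factor, so a nested induction leaves only a product of
  two single terms, where \<open>monomial_eval_add\<close> applies.\<close>

lemma mpoly_eval_mult: "mpoly_eval x (p * q) = mpoly_eval x p * mpoly_eval x q"
proof (induction p rule: mpoly_induct)
  case zero
  show ?case by (simp add: mpoly_eval_0)
next
  case (add_single p m c)
  have "mpoly_eval x (Poly_Mapping.single m c * q) =
          mpoly_eval x (Poly_Mapping.single m c) * mpoly_eval x q"
  proof (induction q rule: mpoly_induct)
    case zero
    show ?case by (simp add: mpoly_eval_0)
  next
    case (add_single q n d)
    thus ?case
      by (simp add: distrib_left mult_single mpoly_eval_add mpoly_eval_single
          monomial_eval_add of_rat_mult)
  qed
  with add_single show ?case by (simp add: distrib_right mpoly_eval_add)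
qed

text \<open>The rational subalgebra of the complex numbers generated by zeta(2), zeta(3), and so on.
  Index 0, which would stand for zeta(1), is excluded.\<close>

definition zeta_algebra :: "complex set" where
  "zeta_algebra = {mpoly_eval (\<lambda>j. riemann_zeta (of_nat (j + 1))) p |p. mpoly_vars p \<subseteq> {j. j \<ge> 1}}"

lemma zeta_algebraI:
  "z = mpoly_eval (\<lambda>j. riemann_zeta (of_nat (j + 1))) p \<Longrightarrow> mpoly_vars p \<subseteq> {j. j \<ge> 1}
     \<Longrightarrow> z \<in> zeta_algebra"
  by (auto simp: zeta_algebra_def)

lemma zeta_algebra_add: "x \<in> zeta_algebra \<Longrightarrow> y \<in> zeta_algebra \<Longrightarrow> x + y \<in> zeta_algebra"
proof -
  assume "x \<in> zeta_algebra" "y \<in> zeta_algebra"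
  then obtain p q where
    "x = mpoly_eval (\<lambda>j. riemann_zeta (of_nat (j + 1))) p" "mpoly_vars p \<subseteq> {j. j \<ge> 1}"
    "y = mpoly_eval (\<lambda>j. riemann_zeta (of_nat (j + 1))) q" "mpoly_vars q \<subseteq> {j. j \<ge> 1}"
    by (auto simp: zeta_algebra_def)
  moreover have "mpoly_vars (p + q) \<subseteq> mpoly_vars p \<union> mpoly_vars q"
    using keys_add[of p q] unfolding mpoly_vars_def by blast
  ultimately show ?thesis
    by (intro zeta_algebraI[of _ "p + q"]) (auto simp: mpoly_eval_add)
qed

lemma zeta_algebra_mult: "x \<in> zeta_algebra \<Longrightarrow> y \<in> zeta_algebra \<Longrightarrow> x * y \<in> zeta_algebra"
proof -
  assume "x \<in> zeta_algebra" "y \<in> zeta_algebra"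
  then obtain p q where
    "x = mpoly_eval (\<lambda>j. riemann_zeta (of_nat (j + 1))) p" "mpoly_vars p \<subseteq> {j. j \<ge> 1}"
    "y = mpoly_eval (\<lambda>j. riemann_zeta (of_nat (j + 1))) q" "mpoly_vars q \<subseteq> {j. j \<ge> 1}"
    by (auto simp: zeta_algebra_def)
  moreover have "mpoly_vars (p * q) \<subseteq> mpoly_vars p \<union> mpoly_vars q"
  proof
    fix j assume "j \<in> mpoly_vars (p * q)"
    then obtain m where m: "m \<in> Poly_Mapping.keys (p * q)" "j \<in> Poly_Mapping.keys m"
      by (auto simp: mpoly_vars_def)
    then obtain u v where uv: "m = u + v" "u \<in> Poly_Mapping.keys p" "v \<in> Poly_Mapping.keys q"
      using keys_mult[of p q] by blast
    with m have "j \<in> Poly_Mapping.keys u \<union> Poly_Mapping.keys v"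
      using keys_add[of u v] by blast
    with uv show "j \<in> mpoly_vars p \<union> mpoly_vars q" by (auto simp: mpoly_vars_def)
  qed
  ultimately show ?thesis
    by (intro zeta_algebraI[of _ "p * q"]) (auto simp: mpoly_eval_mult)
qed

lemma zeta_algebra_of_rat: "of_rat c \<in> zeta_algebra"
  by (rule zeta_algebraI[of _ "Poly_Mapping.single 0 c"])
     (auto simp: mpoly_eval_single monomial_eval_def mpoly_vars_def)

lemma zeta_algebra_Rats: "x \<in> \<rat> \<Longrightarrow> x \<in> zeta_algebra"
  by (auto simp: Rats_def zeta_algebra_of_rat)

lemma zeta_algebra_diff: "x \<in> zeta_algebra \<Longrightarrow> y \<in> zeta_algebra \<Longrightarrow> x - y \<in> zeta_algebra"
  using zeta_algebra_add[of x "-1 * y"] zeta_algebra_mult[of "-1" y] zeta_algebra_Rats[of "-1"]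
  by simp

lemma zeta_algebra_sum:
  "(\<And>i. i \<in> A \<Longrightarrow> f i \<in> zeta_algebra) \<Longrightarrow> sum f A \<in> zeta_algebra"
  by (induction A rule: infinite_finite_induct)
     (auto intro: zeta_algebra_add zeta_algebra_Rats)

lemma riemann_zeta_in_zeta_algebra:
  assumes "k \<ge> 2"
  shows "riemann_zeta (of_nat k) \<in> zeta_algebra"
  by (rule zeta_algebraI[of _ "Poly_Mapping.single (Poly_Mapping.single (k - 1) 1) 1"])
     (use assms in \<open>auto simp: mpoly_eval_single monomial_eval_def mpoly_vars_def of_nat_diff\<close>)

section \<open>Zeta sums over residue classes modulo 2\<close>

text \<open>Absolute convergence turns the series into an unordered sum. It is indexed by positive
  integers because the later coordinates take both signs.\<close>

lemma has_sum_riemann_zeta: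
  assumes "k \<ge> 2"
  shows "((\<lambda>t. inverse (of_int t) ^ k) has_sum riemann_zeta (of_nat k)) {t::int. t > 0}"
proof -
  let ?f = "\<lambda>n. inverse (of_nat (Suc n)) ^ k :: complex"
  have eq: "1 / of_nat (Suc n) powr of_nat k = ?f n" for n
    by (subst powr_nat') (simp_all add: divide_inverse power_inverse del: of_nat_Suc)
  have sm: "summable (\<lambda>n. norm (?f n))"
    unfolding norm_power norm_inverse norm_of_nat power_inverse
    using inverse_power_summable[OF assms, where 'a = real] by (subst summable_Suc_iff)
  hence "?f sums riemann_zeta (of_nat k)"
    unfolding riemann_zeta_def eq by (rule summable_sums[OF summable_norm_cancel])
  hence "(?f has_sum riemann_zeta (of_nat k)) UNIV"
    using sm by (intro norm_summable_imp_has_sum)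
  also have "?this \<longleftrightarrow> ?thesis"
    by (rule has_sum_reindex_bij_witness[of _ "\<lambda>t. nat t - 1" "\<lambda>n. int (Suc n)"]) auto
  finally show ?thesis .
qed

text \<open>The even numbers \<open>2 * n\<close> contribute \<open>inverse 2 ^ k\<close> times the
  zeta value; the odd ones contribute the remainder.\<close>

lemma zeta_parity_has_sum:
  assumes "k \<ge> 2"
  obtains L where "L \<in> zeta_algebra"
    "((\<lambda>t. inverse (of_int t) ^ k) has_sum L) {t::int. t > 0 \<and> odd t = \<sigma>}"
proof -
  let ?f = "\<lambda>t::int. inverse (of_int t) ^ k :: complex" and ?Z = "riemann_zeta (of_nat k)"
  let ?e = "inverse 2 ^ k * ?Z"
  have Z: "?Z \<in> zeta_algebra" using assms by (rule riemann_zeta_in_zeta_algebra)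
  have e: "?e \<in> zeta_algebra"
    by (intro zeta_algebra_mult Z zeta_algebra_Rats) auto
  have "((\<lambda>t. inverse 2 ^ k * ?f t) has_sum ?e) {t. t > 0}"
    by (intro has_sum_cmult_right has_sum_riemann_zeta assms)
  also have "?this \<longleftrightarrow> (?f has_sum ?e) {t. t > 0 \<and> even t}"
    by (rule has_sum_reindex_bij_witness[of _ "\<lambda>t. t div 2" "\<lambda>n. 2 * n"])
       (auto simp: power_mult_distrib power_divide)
  finally have even: "(?f has_sum ?e) {t. t > 0 \<and> even t}" .
  have "(?f has_sum (?Z - ?e)) ({t. t > 0} - {t. t > 0 \<and> even t})"
    by (rule has_sum_Diff[OF has_sum_riemann_zeta[OF assms] even]) auto
  also have "{t. t > 0} - {t. t > 0 \<and> even t} = {t::int. t > 0 \<and> odd t}" by auto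
  finally have odd: "(?f has_sum (?Z - ?e)) {t. t > 0 \<and> odd t}" .
  show ?thesis
  proof (cases \<sigma>)
    case True
    show ?thesis by (rule that[OF zeta_algebra_diff[OF Z e]]) (use odd True in simp)
  next
    case False
    show ?thesis by (rule that[OF e]) (use even False in simp)
  qed
qed

section \<open>Symmetric summation over the integers\<close>

text \<open>A principal value at infinity. Terms of degree 1 have no unordered sum over the
  integers, but their symmetric partial sums converge.\<close>

definition pv_sum :: "(int \<Rightarrow> complex) \<Rightarrow> complex \<Rightarrow> bool" where
  "pv_sum g L \<longleftrightarrow> (\<lambda>N. \<Sum>x\<in>{-int N..int N}. g x) \<longlonglongrightarrow> L"

lemma pv_sum_add: "pv_sum f K \<Longrightarrow> pv_sum g L \<Longrightarrow> pv_sum (\<lambda>x. f x + g x) (K + L)"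
  unfolding pv_sum_def sum.distrib by (rule tendsto_add)

lemma pv_sum_diff: "pv_sum f K \<Longrightarrow> pv_sum g L \<Longrightarrow> pv_sum (\<lambda>x. f x - g x) (K - L)"
  unfolding pv_sum_def sum_subtractf by (rule tendsto_diff)

lemma pv_sum_cmult: "pv_sum f K \<Longrightarrow> pv_sum (\<lambda>x. c * f x) (c * K)"
  unfolding pv_sum_def sum_distrib_left[symmetric] by (intro tendsto_mult tendsto_const)

lemma sum_symmetric_uminus:
  fixes g :: "int \<Rightarrow> 'a::comm_monoid_add"
  shows "(\<Sum>x\<in>{-int N..int N}. g (- x)) = (\<Sum>x\<in>{-int N..int N}. g x)"
  by (rule sum.reindex_bij_witness[of _ uminus uminus]) auto

lemma pv_sum_uminus: "pv_sum f K \<Longrightarrow> pv_sum (\<lambda>x. f (- x)) K"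
  unfolding pv_sum_def sum_symmetric_uminus .

lemma pv_sum_odd:
  assumes "\<And>x. g (- x) = - g x"
  shows "pv_sum g 0"
proof -
  have "(\<Sum>x\<in>{-int N..int N}. g x) = 0" for N
    using sum_symmetric_uminus[of g N] by (simp add: assms sum_negf)
  thus ?thesis by (simp add: pv_sum_def)
qed

lemma filterlim_symmetric_intervals:
  "filterlim (\<lambda>N. {-int N..int N}) (finite_subsets_at_top UNIV) sequentially"
  unfolding filterlim_finite_subsets_at_top
proof safe
  fix X :: "int set" assume X: "finite X"
  \<comment> \<open>\<open>M\<close> bounds the absolute value of every element of \<open>X\<close>,
    so the interval for any \<open>N\<close> at least \<open>M\<close> contains
    \<open>X\<close>.\<close>
  define M where "M = (\<Sum>x\<in>X. nat \<bar>x\<bar>)"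
  have M: "nat \<bar>x\<bar> \<le> M" if "x \<in> X" for x
    unfolding M_def using X that by (intro member_le_sum) auto
  have "X \<subseteq> {-int N..int N}" if "N \<ge> M" for N
  proof
    fix x assume "x \<in> X"
    with M[of x] that show "x \<in> {-int N..int N}" by auto
  qed
  thus "\<forall>\<^sub>F N in sequentially. finite {-int N..int N} \<and> X \<subseteq> {-int N..int N} \<and>
          {-int N..int N} \<subseteq> UNIV"
    unfolding eventually_sequentially by auto
qed

lemma has_sum_imp_pv_sum: "(g has_sum L) UNIV \<Longrightarrow> pv_sum g L"
  unfolding pv_sum_def has_sum_def by (rule filterlim_compose[OF _ filterlim_symmetric_intervals])

lemma pv_sum_unique: "pv_sum g K \<Longrightarrow> pv_sum g L \<Longrightarrow> K = L"
  unfolding pv_sum_def by (rule LIMSEQ_unique)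

lemma pv_sum_remove:
  assumes "finite F" "pv_sum g L"
  shows "pv_sum (\<lambda>x. if x \<in> F then 0 else g x) (L - sum g F)"
proof -
  have "((\<lambda>x. if x \<in> F then g x else 0) has_sum sum g F) UNIV"
    using has_sum_finite[OF assms(1), of g]
    by (subst has_sum_cong_neutral[of F UNIV g]) auto
  from pv_sum_diff[OF assms(2) has_sum_imp_pv_sum[OF this]] show ?thesis
    by (rule back_subst[of "\<lambda>f. pv_sum f _"]) auto
qed

text \<open>Shifting the summation window by one adds a term at one end and drops one at the other,
  and both tend to 0. No absolute convergence is involved, so exponent 1 is covered.\<close>

lemma pv_sum_shift:
  assumes "pv_sum g L" "(\<lambda>n. g (int n)) \<longlonglongrightarrow> 0" "(\<lambda>n. g (- int n)) \<longlonglongrightarrow> 0"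
  shows "pv_sum (\<lambda>x. g (int t - x)) L"
proof (induction t)
  case 0
  show ?case using pv_sum_uminus[OF assms(1)] by simp
next
  case (Suc t)
  have eq: "(\<Sum>x\<in>{-int N..int N}. g (int (Suc t) - x)) =
        (\<Sum>x\<in>{-int N..int N}. g (int t - x)) + g (int (N + Suc t)) - g (int t - int N)" for N
  proof -
    have "(\<Sum>x\<in>{-int N..int N}. g (int (Suc t) - x)) = sum g {int t + 1 - int N..int t + 1 + int N}"
      by (rule sum.reindex_bij_witness[of _ "\<lambda>u. int t + 1 - u" "\<lambda>u. int t + 1 - u"])
         (auto simp: algebra_simps)
    moreover have "(\<Sum>x\<in>{-int N..int N}. g (int t - x)) = sum g {int t - int N..int t + int N}"
      by (rule sum.reindex_bij_witness[of _ "\<lambda>u. int t - u" "\<lambda>u. int t - u"]) auto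
    \<comment> \<open>Both sides are the interval from \<open>int t - int N\<close> to
      \<open>int t + 1 + int N\<close>, the union of the two consecutive windows.\<close>
    moreover have "insert (int t - int N) {int t + 1 - int N..int t + 1 + int N} =
                   insert (int t + 1 + int N) {int t - int N..int t + int N}" by auto
    hence "sum g (insert (int t - int N) {int t + 1 - int N..int t + 1 + int N}) =
           sum g (insert (int t + 1 + int N) {int t - int N..int t + int N})" by simp
    hence "g (int t - int N) + sum g {int t + 1 - int N..int t + 1 + int N} =
           g (int t + 1 + int N) + sum g {int t - int N..int t + int N}" by simp
    ultimately show ?thesis by (simp add: algebra_simps)
  qed
  have "(\<lambda>N. g (int (N + Suc t))) \<longlonglongrightarrow> 0"
    using LIMSEQ_ignore_initial_segment[OF assms(2), of "Suc t"] by simp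
  moreover have "(\<lambda>N. g (int t - int N)) \<longlonglongrightarrow> 0"
    by (rule LIMSEQ_offset[of _ t]) (use assms(3) in simp)
  ultimately have "(\<lambda>N. (\<Sum>x\<in>{-int N..int N}. g (int t - x)) + g (int (N + Suc t)) - g (int t - int N))
      \<longlonglongrightarrow> L + 0 - 0"
    using Suc.IH unfolding pv_sum_def by (intro tendsto_intros)
  thus ?case unfolding pv_sum_def eq by simp
qed

section \<open>Principal values of inverse powers over a parity class\<close>

definition parity_inv_power :: "bool \<Rightarrow> nat \<Rightarrow> int \<Rightarrow> complex" where
  "parity_inv_power \<rho> i x = (if odd x = \<rho> then inverse (of_int x) ^ i else 0)"

lemma parity_inv_power_uminus: "parity_inv_power \<rho> i (- x) = (-1) ^ i * parity_inv_power \<rho> i x"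
  by (simp add: parity_inv_power_def flip: power_mult_distrib)

lemma parity_inv_power_tendsto_0:
  assumes "i \<ge> 1"
  shows "(\<lambda>n. parity_inv_power \<rho> i (int n)) \<longlonglongrightarrow> 0"
    and "(\<lambda>n. parity_inv_power \<rho> i (- int n)) \<longlonglongrightarrow> 0"
proof -
  have "(\<lambda>n. inverse (of_nat n) ^ i :: complex) \<longlonglongrightarrow> 0"
    using assms by (intro tendsto_null_power tendsto_inverse_0_at_top lim_inverse_n) auto
  hence *: "(\<lambda>n. norm (inverse (of_nat n) ^ i :: complex)) \<longlonglongrightarrow> 0"
    by (rule tendsto_norm_zero)
  show "(\<lambda>n. parity_inv_power \<rho> i (int n)) \<longlonglongrightarrow> 0"
    by (rule Lim_null_comparison[OF _ *]) (auto simp: parity_inv_power_def)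
  from tendsto_mult[OF tendsto_const this, of "(-1) ^ i"]
  show "(\<lambda>n. parity_inv_power \<rho> i (- int n)) \<longlonglongrightarrow> 0"
    by (simp add: parity_inv_power_uminus)
qed

text \<open>For odd \<open>i\<close>, including the conditionally convergent case
  \<open>i = 1\<close>, opposite terms cancel. For even \<open>i\<close> the sum converges
  absolutely and is twice the sum over the positive integers.\<close>

lemma pv_sum_parity_inv_power:
  assumes "i \<ge> 1"
  obtains L where "L \<in> zeta_algebra" "pv_sum (parity_inv_power \<rho> i) L"
proof (cases "even i")
  case False
  have "pv_sum (parity_inv_power \<rho> i) 0"
    by (rule pv_sum_odd) (use False in \<open>simp add: parity_inv_power_uminus\<close>)
  thus ?thesis by (intro that[of 0] zeta_algebra_Rats) auto
next
  case True
  with assms have "i \<ge> 2" by (cases "i = 1") auto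
  then obtain L where L: "L \<in> zeta_algebra"
    "((\<lambda>t. inverse (of_int t) ^ i) has_sum L) {t::int. t > 0 \<and> odd t = \<rho>}"
    using zeta_parity_has_sum by blast
  have pos: "(parity_inv_power \<rho> i has_sum L) {x. x > 0}"
    using L(2) by (subst has_sum_cong_neutral[where T = "{t::int. t > 0 \<and> odd t = \<rho>}"])
      (auto simp: parity_inv_power_def)
  hence neg: "(parity_inv_power \<rho> i has_sum L) {x. x < 0}"
    by (subst (asm) has_sum_reindex_bij_witness[of _ uminus uminus "{x. x < 0}" "parity_inv_power \<rho> i" _ L L])
       (use True in \<open>auto simp: parity_inv_power_uminus\<close>)
  have "(parity_inv_power \<rho> i has_sum (L + L)) ({x. x > 0} \<union> {x. x < 0})"
    by (rule has_sum_Un_disjoint[OF pos neg]) auto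
  \<comment> \<open>The remaining point 0 contributes nothing: if its parity matches, its term is
    \<open>inverse 0 ^ i = 0\<close> with \<open>i\<close> positive.\<close>
  hence "(parity_inv_power \<rho> i has_sum (L + L)) UNIV"
    by (subst has_sum_cong_neutral[where T = "{x. x > 0} \<union> {x. x < 0}"])
       (use assms in \<open>auto simp: parity_inv_power_def linorder_neq_iff\<close>)
  thus ?thesis using that zeta_algebra_add[OF L(1) L(1)] has_sum_imp_pv_sum by blast
qed

section \<open>Partial fractions for the inner sum\<close>

text \<open>The poles are excluded explicitly: with \<open>inverse 0 = 0\<close> the partial fraction identities
  would fail there.\<close>

definition kernel :: "bool \<Rightarrow> nat \<Rightarrow> nat \<Rightarrow> nat \<Rightarrow> int \<Rightarrow> int \<Rightarrow> complex" where
  "kernel \<rho> p q s t x = (if odd x = \<rho> \<and> x \<notin> {0, t, - t} then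
     inverse (of_int x) ^ p * inverse (of_int (t - x)) ^ q * inverse (of_int (t + x)) ^ s else 0)"

text \<open>The three identities come from t = x + (t - x), t = (t + x) - x and 2t = (t - x) + (t +
  x). Each lowers the total exponent by one at the price of a factor 1/t.\<close>

lemma kernel_partial_fractions:
  assumes "t > 0"
  shows "kernel \<rho> (Suc p) (Suc q) s t x =
           inverse (of_int t) * (kernel \<rho> p (Suc q) s t x + kernel \<rho> (Suc p) q s t x)"
    and "kernel \<rho> (Suc p) q (Suc s) t x =
           inverse (of_int t) * (kernel \<rho> (Suc p) q s t x - kernel \<rho> p q (Suc s) t x)"
    and "kernel \<rho> p (Suc q) (Suc s) t x =
           inverse (of_int t) * (inverse 2 * (kernel \<rho> p q (Suc s) t x + kernel \<rho> p (Suc q) s t x))"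
proof -
  define H :: complex where "H = inverse 2"
  define X Y Z T :: complex where "X = of_int x" and "Y = of_int (t - x)"
    and "Z = of_int (t + x)" and "T = of_int t"
  have T: "T \<noteq> 0" "T = X + Y" "T = Z - X" "2 * T = Y + Z"
    using assms by (auto simp: X_def Y_def Z_def T_def)
  have nz: "X \<noteq> 0" "Y \<noteq> 0" "Z \<noteq> 0" if "x \<notin> {0, t, - t}"
    using that by (auto simp: X_def Y_def Z_def simp del: of_int_diff of_int_add)
  have pf: "inverse X * inverse Y = inverse T * (inverse Y + inverse X)"
    "inverse X * inverse Z = inverse T * (inverse X - inverse Z)"
    "inverse Y * inverse Z = inverse T * (inverse 2 * (inverse Z + inverse Y))"
    if "x \<notin> {0, t, - t}"
  proof -
    show "inverse X * inverse Y = inverse T * (inverse Y + inverse X)"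
      using nz[OF that] T(1) by (simp add: field_simps T(2))
    show "inverse X * inverse Z = inverse T * (inverse X - inverse Z)"
      using nz[OF that] T(1) by (simp add: field_simps T(3))
    have "inverse Y + inverse Z = (2 * T) * (inverse Y * inverse Z)"
      using nz[OF that] unfolding T(4) by (simp add: field_simps)
    thus "inverse Y * inverse Z = inverse T * (inverse 2 * (inverse Z + inverse Y))"
      using T(1) by (simp add: add.commute[of "inverse Z"])
  qed
  have K: "kernel \<rho> p q s t x = (if odd x = \<rho> \<and> x \<notin> {0, t, - t} then
      inverse X ^ p * inverse Y ^ q * inverse Z ^ s else 0)" for p q s
    unfolding kernel_def X_def Y_def Z_def ..
  show "kernel \<rho> (Suc p) (Suc q) s t x =
           inverse (of_int t) * (kernel \<rho> p (Suc q) s t x + kernel \<rho> (Suc p) q s t x)"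
  proof (cases "odd x = \<rho> \<and> x \<notin> {0, t, - t}")
    case True
    have "inverse X ^ Suc p * inverse Y ^ Suc q * inverse Z ^ s =
          (inverse X * inverse Y) * (inverse X ^ p * inverse Y ^ q * inverse Z ^ s)"
      by simp
    also have "\<dots> = inverse T * (inverse Y + inverse X) * (inverse X ^ p * inverse Y ^ q * inverse Z ^ s)"
      using pf(1) True by simp
    finally show ?thesis using True
      unfolding K T_def[symmetric] by (simp add: algebra_simps del: inverse_mult_distrib)
  qed (auto simp: K)
  show "kernel \<rho> (Suc p) q (Suc s) t x =
           inverse (of_int t) * (kernel \<rho> (Suc p) q s t x - kernel \<rho> p q (Suc s) t x)"
  proof (cases "odd x = \<rho> \<and> x \<notin> {0, t, - t}")
    case True
    have "inverse X ^ Suc p * inverse Y ^ q * inverse Z ^ Suc s =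
          (inverse X * inverse Z) * (inverse X ^ p * inverse Y ^ q * inverse Z ^ s)"
      by simp
    also have "\<dots> = inverse T * (inverse X - inverse Z) * (inverse X ^ p * inverse Y ^ q * inverse Z ^ s)"
      using pf(2) True by simp
    finally show ?thesis using True
      unfolding K T_def[symmetric] by (simp add: algebra_simps del: inverse_mult_distrib)
  qed (auto simp: K)
  show "kernel \<rho> p (Suc q) (Suc s) t x =
           inverse (of_int t) * (inverse 2 * (kernel \<rho> p q (Suc s) t x + kernel \<rho> p (Suc q) s t x))"
  proof (cases "odd x = \<rho> \<and> x \<notin> {0, t, - t}")
    case True
    have "inverse X ^ p * inverse Y ^ Suc q * inverse Z ^ Suc s =
          (inverse Y * inverse Z) * (inverse X ^ p * inverse Y ^ q * inverse Z ^ s)"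
      by simp
    also have "\<dots> = inverse T * (H * (inverse Z + inverse Y)) *
          (inverse X ^ p * inverse Y ^ q * inverse Z ^ s)"
      unfolding H_def using pf(3) True by metis
    finally show ?thesis using True
      unfolding K T_def[symmetric] H_def[symmetric] by (simp add: algebra_simps del: inverse_mult_distrib)
  qed (auto simp: K)
qed

section \<open>Inner sums as polynomials in 1/t\<close>

definition zeta_poly :: "complex poly \<Rightarrow> bool" where
  "zeta_poly P \<longleftrightarrow> (\<forall>k. coeff P k \<in> zeta_algebra)"

lemma zeta_poly_add: "zeta_poly P \<Longrightarrow> zeta_poly Q \<Longrightarrow> zeta_poly (P + Q)"
  by (simp add: zeta_poly_def zeta_algebra_add)

lemma zeta_poly_diff: "zeta_poly P \<Longrightarrow> zeta_poly Q \<Longrightarrow> zeta_poly (P - Q)"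
  by (simp add: zeta_poly_def zeta_algebra_diff)

lemma zeta_poly_smult: "c \<in> zeta_algebra \<Longrightarrow> zeta_poly P \<Longrightarrow> zeta_poly (smult c P)"
  by (simp add: zeta_poly_def zeta_algebra_mult)

lemma zeta_poly_monom: "c \<in> zeta_algebra \<Longrightarrow> zeta_poly (monom c n)"
  by (simp add: zeta_poly_def zeta_algebra_Rats)

lemma zeta_poly_pCons: "c \<in> zeta_algebra \<Longrightarrow> zeta_poly P \<Longrightarrow> zeta_poly (pCons c P)"
  by (auto simp: zeta_poly_def coeff_pCons split: nat.split)

text \<open>Here \<open>\<rho>\<close> is the parity of the inner variable x and
  \<open>\<sigma>\<close> that of t. A single \<open>P\<close> must serve every t of the given
  parity; this uniformity is what makes the outer sum computable.\<close>

definition pv_kernel_poly :: "bool \<Rightarrow> bool \<Rightarrow> nat \<Rightarrow> nat \<Rightarrow> nat \<Rightarrow> complex poly \<Rightarrow> bool" where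
  "pv_kernel_poly \<rho> \<sigma> p q s P \<longleftrightarrow> zeta_poly P \<and>
     (\<forall>t>0. odd t = \<sigma> \<longrightarrow> pv_sum (kernel \<rho> p q s t) (poly P (inverse (of_int t))))"

text \<open>Multiplication by 1/t is \<open>pCons 0\<close> on the polynomial side; this is the
  common part of the three reduction steps.\<close>

lemma pv_kernel_poly_pCons:
  assumes "zeta_poly P" "\<And>t. t > 0 \<Longrightarrow> odd t = \<sigma> \<Longrightarrow> pv_sum (g t) (poly P (inverse (of_int t)))"
    and "\<And>t x. t > 0 \<Longrightarrow> kernel \<rho> p q s t x = inverse (of_int t) * g t x"
  shows "pv_kernel_poly \<rho> \<sigma> p q s (pCons 0 P)"
  unfolding pv_kernel_poly_def
proof (intro conjI allI impI)
  show "zeta_poly (pCons 0 P)" by (intro zeta_poly_pCons assms zeta_algebra_Rats) auto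
next
  fix t :: int assume "t > 0" and "odd t = \<sigma>"
  with pv_sum_cmult[OF assms(2), of t "inverse (of_int t)"]
  have "pv_sum (kernel \<rho> p q s t) (inverse (of_int t) * poly P (inverse (of_int t)))"
    by (subst ext[of "kernel \<rho> p q s t", OF assms(3)]) auto
  thus "pv_sum (kernel \<rho> p q s t) (poly (pCons 0 P) (inverse (of_int t)))" by simp
qed

lemma pv_kernel_poly_step12:
  assumes "pv_kernel_poly \<rho> \<sigma> p (Suc q) s P" "pv_kernel_poly \<rho> \<sigma> (Suc p) q s Q"
  shows "pv_kernel_poly \<rho> \<sigma> (Suc p) (Suc q) s (pCons 0 (P + Q))"
  by (rule pv_kernel_poly_pCons[OF _ _ kernel_partial_fractions(1)])
     (use assms in \<open>auto simp: pv_kernel_poly_def intro: zeta_poly_add pv_sum_add\<close>)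

lemma pv_kernel_poly_step13:
  assumes "pv_kernel_poly \<rho> \<sigma> (Suc p) q s P" "pv_kernel_poly \<rho> \<sigma> p q (Suc s) Q"
  shows "pv_kernel_poly \<rho> \<sigma> (Suc p) q (Suc s) (pCons 0 (P - Q))"
  by (rule pv_kernel_poly_pCons[OF _ _ kernel_partial_fractions(2)])
     (use assms in \<open>auto simp: pv_kernel_poly_def intro: zeta_poly_diff pv_sum_diff\<close>)

lemma pv_kernel_poly_step23:
  assumes "pv_kernel_poly \<rho> \<sigma> p q (Suc s) P" "pv_kernel_poly \<rho> \<sigma> p (Suc q) s Q"
  shows "pv_kernel_poly \<rho> \<sigma> p (Suc q) (Suc s) (pCons 0 (smult (inverse 2) (P + Q)))"
proof (rule pv_kernel_poly_pCons[OF _ _ kernel_partial_fractions(3)])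
  show "zeta_poly (smult (inverse 2) (P + Q))"
    using assms by (intro zeta_poly_smult zeta_poly_add zeta_algebra_Rats)
      (auto simp: pv_kernel_poly_def)
  show "pv_sum (\<lambda>x. inverse 2 * (kernel \<rho> p q (Suc s) t x + kernel \<rho> p (Suc q) s t x))
          (poly (smult (inverse 2) (P + Q)) (inverse (of_int t)))"
    if "t > 0" "odd t = \<sigma>" for t
    unfolding poly_smult poly_add
    by (intro pv_sum_cmult pv_sum_add) (use assms that in \<open>auto simp: pv_kernel_poly_def\<close>)
qed

text \<open>The principal value over the whole parity class is independent of t; removing the
  excluded points corrects it by a multiple of 1/t^p.\<close>

lemma pv_kernel_poly_base1:
  assumes "p \<ge> 1"
  shows "\<exists>P. pv_kernel_poly \<rho> \<sigma> p 0 0 P"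
proof -
  obtain L where L: "L \<in> zeta_algebra" "pv_sum (parity_inv_power \<rho> p) L"
    using pv_sum_parity_inv_power[OF assms] by blast
  \<comment> \<open>The points t and -t belong to the class only if
    \<open>\<rho> = \<sigma>\<close>, and then contribute 1 and (-1)^p times 1/t^p. The point 0
    contributes 0.\<close>
  define c :: complex where "c = (if \<rho> = \<sigma> then 1 + (-1) ^ p else 0)"
  have c: "c \<in> zeta_algebra" unfolding c_def by (rule zeta_algebra_Rats) auto
  have "pv_kernel_poly \<rho> \<sigma> p 0 0 (monom L 0 - monom c p)"
    unfolding pv_kernel_poly_def
  proof (intro conjI allI impI)
    show "zeta_poly (monom L 0 - monom c p)" by (intro zeta_poly_diff zeta_poly_monom c L)
  next
    fix t :: int assume t: "t > 0" and \<sigma>: "odd t = \<sigma>"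
    have "sum (parity_inv_power \<rho> p) {0, t, - t} = c * inverse (of_int t) ^ p"
      using t \<sigma> assms
      by (auto simp: parity_inv_power_uminus parity_inv_power_def c_def algebra_simps power_0_left
          simp flip: power_mult_distrib)
    with pv_sum_remove[OF _ L(2), of "{0, t, - t}"]
    have "pv_sum (\<lambda>x. if x \<in> {0, t, - t} then 0 else parity_inv_power \<rho> p x)
            (poly (monom L 0 - monom c p) (inverse (of_int t)))"
      by (simp add: poly_monom)
    thus "pv_sum (kernel \<rho> p 0 0 t) (poly (monom L 0 - monom c p) (inverse (of_int t)))"
      by (rule back_subst[of "\<lambda>f. pv_sum f _"]) (auto simp: kernel_def parity_inv_power_def)
  qed
  thus ?thesis by blast
qed

text \<open>The substitution u = t - x reduces this to inverse powers of u;
  \<open>pv_sum_shift\<close> shows that the shifted window has the same limit.\<close>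

lemma pv_kernel_poly_base2:
  assumes "q \<ge> 1"
  shows "\<exists>P. pv_kernel_poly \<rho> \<sigma> 0 q 0 P"
proof -
  \<comment> \<open>The parity of t - x when x has parity \<open>\<rho>\<close> and t has parity
    \<open>\<sigma>\<close>.\<close>
  define \<tau> where "\<tau> = (\<rho> \<noteq> \<sigma>)"
  obtain L where L: "L \<in> zeta_algebra" "pv_sum (parity_inv_power \<tau> q) L"
    using pv_sum_parity_inv_power[OF assms] by blast
  \<comment> \<open>At x = 0 the term is 1/t^q if \<open>\<tau> = \<sigma>\<close>. At x = -t it is
    1/(2t)^q, present only if \<open>\<tau>\<close> is the even class. At x = t it is 0.\<close>
  define c :: complex where
    "c = (if \<tau> = \<sigma> then 1 else 0) + (if \<tau> then 0 else inverse 2 ^ q)"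
  have c: "c \<in> zeta_algebra" unfolding c_def by (rule zeta_algebra_Rats) auto
  have "pv_kernel_poly \<rho> \<sigma> 0 q 0 (monom L 0 - monom c q)"
    unfolding pv_kernel_poly_def
  proof (intro conjI allI impI)
    show "zeta_poly (monom L 0 - monom c q)" by (intro zeta_poly_diff zeta_poly_monom c L)
  next
    fix t :: int assume t: "t > 0" and \<sigma>: "odd t = \<sigma>"
    define g where "g = (\<lambda>x. parity_inv_power \<tau> q (t - x))"
    have g: "pv_sum g L"
      using pv_sum_shift[OF L(2) parity_inv_power_tendsto_0, of "nat t"] assms t
      by (simp add: g_def)
    have "sum g {0, t, - t} = c * inverse (of_int t) ^ q"
      using t \<sigma> assms by (auto simp: g_def parity_inv_power_def c_def algebra_simps power_0_left
          simp flip: power_mult_distrib)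
    with pv_sum_remove[OF _ g, of "{0, t, - t}"]
    have "pv_sum (\<lambda>x. if x \<in> {0, t, - t} then 0 else g x)
            (poly (monom L 0 - monom c q) (inverse (of_int t)))"
      by (simp add: poly_monom)
    thus "pv_sum (kernel \<rho> 0 q 0 t) (poly (monom L 0 - monom c q) (inverse (of_int t)))"
      by (rule back_subst[of "\<lambda>f. pv_sum f _"])
         (use \<sigma> in \<open>auto simp: kernel_def g_def parity_inv_power_def \<tau>_def\<close>)
  qed
  thus ?thesis by blast
qed

text \<open>The reflection of x to -x exchanges t - x and t + x and preserves both the parity class
  and the excluded points.\<close>

lemma pv_kernel_poly_base3:
  assumes "s \<ge> 1"
  shows "\<exists>P. pv_kernel_poly \<rho> \<sigma> 0 0 s P"
proof -
  obtain P where P: "pv_kernel_poly \<rho> \<sigma> 0 s 0 P"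
    using pv_kernel_poly_base2[OF assms] by blast
  have "kernel \<rho> 0 0 s t = (\<lambda>x. kernel \<rho> 0 s 0 t (- x))" for t
    by (auto simp: kernel_def)
  with P have "pv_kernel_poly \<rho> \<sigma> 0 0 s P"
    by (auto simp: pv_kernel_poly_def intro: pv_sum_uminus)
  thus ?thesis by blast
qed

text \<open>Induction on the total exponent: two positive exponents allow a partial fraction step,
  which leaves a total of at least 1, and a single positive exponent is a base case.\<close>

lemma pv_kernel_poly_exists:
  assumes "p + q + s \<ge> 1"
  shows "\<exists>P. pv_kernel_poly \<rho> \<sigma> p q s P"
  using assms
proof (induction "p + q + s" arbitrary: p q s rule: less_induct)
  case less
  consider p' q' where "p = Suc p'" "q = Suc q'" | p' s' where "p = Suc p'" "s = Suc s'"
    | q' s' where "q = Suc q'" "s = Suc s'"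
    | "p \<ge> 1" "q = 0" "s = 0" | "q \<ge> 1" "p = 0" "s = 0" | "s \<ge> 1" "p = 0" "q = 0"
    using less.prems by (cases p; cases q; cases s) auto
  thus ?case
  proof cases
    case 1
    thus ?thesis using less.hyps[of p' q s] less.hyps[of p q' s] pv_kernel_poly_step12 by fastforce
  next
    case 2
    thus ?thesis using less.hyps[of p q s'] less.hyps[of p' q s] pv_kernel_poly_step13 by fastforce
  next
    case 3
    thus ?thesis using less.hyps[of p q' s] less.hyps[of p q s'] pv_kernel_poly_step23 by fastforce
  qed (use pv_kernel_poly_base1 pv_kernel_poly_base2 pv_kernel_poly_base3 in auto)
qed

text \<open>The vanishing constant coefficient makes the outer sum converge.\<close>

lemma pv_kernel_poly_exists_pCons:
  assumes "p \<ge> 1" "q \<ge> 1"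
  shows "\<exists>P. pv_kernel_poly \<rho> \<sigma> p q s (pCons 0 P)"
proof -
  obtain p' q' where pq: "p = Suc p'" "q = Suc q'"
    using assms by (metis Suc_le_D One_nat_def)
  obtain P Q where "pv_kernel_poly \<rho> \<sigma> p' q s P" "pv_kernel_poly \<rho> \<sigma> p q' s Q"
    using pv_kernel_poly_exists[of p' q s \<rho> \<sigma>] pv_kernel_poly_exists[of p q' s \<rho> \<sigma>] assms by force
  thus ?thesis using pv_kernel_poly_step12 pq by blast
qed

section \<open>The sum over all lines\<close>

lemma has_sum_sum:
  fixes f :: "'i \<Rightarrow> 'a \<Rightarrow> 'b::topological_comm_monoid_add"
  assumes "\<And>i. i \<in> I \<Longrightarrow> (f i has_sum L i) A"
  shows "((\<lambda>x. \<Sum>i\<in>I. f i x) has_sum (\<Sum>i\<in>I. L i)) A"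
  using assms by (induction I rule: infinite_finite_induct) (auto intro: has_sum_add)

text \<open>The inner sum is a polynomial in 1/t without constant term, so the outer sum is a finite
  combination of sums of 1/t^n with n at least 2.\<close>

lemma kernel_double_sum_in_zeta_algebra:
  assumes "p \<ge> 1" "q \<ge> 1" "k \<ge> 1"
    and "((\<lambda>(t, x). kernel \<rho> p q s t x * inverse (of_int t) ^ k) has_sum V)
           ({t. t > 0 \<and> odd t = \<sigma>} \<times> UNIV)"
  shows "V \<in> zeta_algebra"
proof -
  let ?A = "{t::int. t > 0 \<and> odd t = \<sigma>}"
  obtain P where P: "pv_kernel_poly \<rho> \<sigma> p q s (pCons 0 P)"
    using pv_kernel_poly_exists_pCons[OF assms(1,2)] by blast
  have inner: "((\<lambda>x. kernel \<rho> p q s t x * inverse (of_int t) ^ k) has_sum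
      poly P (inverse (of_int t)) * inverse (of_int t) ^ Suc k) UNIV" if t: "t \<in> ?A" for t
  proof -
    let ?h = "\<lambda>x. inverse (of_int t) ^ k * kernel \<rho> p q s t x"
    have "(\<lambda>(t, x). kernel \<rho> p q s t x * inverse (of_int t) ^ k) summable_on ?A \<times> UNIV"
      using assms(4) by (rule has_sum_imp_summable)
    \<comment> \<open>Summability over the pairs gives an unordered inner sum for each t, which must
      agree with the principal value.\<close>
    from summable_on_SigmaD1[OF this t] obtain K where K: "(?h has_sum K) UNIV"
      by (auto simp: summable_on_def mult.commute)
    have "pv_sum ?h (inverse (of_int t) ^ k * poly (pCons 0 P) (inverse (of_int t)))"
      using P t by (intro pv_sum_cmult) (auto simp: pv_kernel_poly_def)
    with has_sum_imp_pv_sum[OF K]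
    have "K = inverse (of_int t) ^ k * poly (pCons 0 P) (inverse (of_int t))"
      by (rule pv_sum_unique)
    with K show ?thesis by (simp add: mult_ac)
  qed
  have "((\<lambda>t. poly P (inverse (of_int t)) * inverse (of_int t) ^ Suc k) has_sum V) ?A"
    by (rule has_sum_SigmaD[OF assms(4)]) (use inner in auto)
  \<comment> \<open>The exponent \<open>n + Suc k\<close> is at least 2 because \<open>k\<close> is
    positive.\<close>
  moreover have "\<exists>L. L \<in> zeta_algebra \<and>
      ((\<lambda>t. inverse (of_int t) ^ (n + Suc k)) has_sum L) ?A" for n
    using zeta_parity_has_sum[of "n + Suc k" \<sigma>] assms(3) by auto
  then obtain L where L: "\<And>n. L n \<in> zeta_algebra"
      "\<And>n. ((\<lambda>t. inverse (of_int t) ^ (n + Suc k)) has_sum L n) ?A"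
    by metis
  have "((\<lambda>t. \<Sum>n\<le>degree P. coeff P n * inverse (of_int t) ^ (n + Suc k)) has_sum
          (\<Sum>n\<le>degree P. coeff P n * L n)) ?A"
    by (intro has_sum_sum has_sum_cmult_right L)
  hence "((\<lambda>t. poly P (inverse (of_int t)) * inverse (of_int t) ^ Suc k) has_sum
          (\<Sum>n\<le>degree P. coeff P n * L n)) ?A"
    by (simp add: poly_altdef sum_distrib_left sum_distrib_right power_add mult_ac)
  ultimately have "V = (\<Sum>n\<le>degree P. coeff P n * L n)" by (rule has_sum_unique)
  also have "zeta_poly P"
    unfolding zeta_poly_def
  proof
    fix n
    have "coeff (pCons 0 P) (Suc n) \<in> zeta_algebra"
      using P unfolding pv_kernel_poly_def zeta_poly_def by blast
    thus "coeff P n \<in> zeta_algebra" by simp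
  qed
  hence "(\<Sum>n\<le>degree P. coeff P n * L n) \<in> zeta_algebra"
    by (intro zeta_algebra_sum zeta_algebra_mult L) (auto simp: zeta_poly_def)
  finally show ?thesis .
qed

section \<open>The reflections of the Weyl chamber\<close>

definition chamber :: "(nat \<times> nat) set" where
  "chamber = {(m, n). m \<ge> 1 \<and> n \<ge> 1 \<and> odd m}"

definition psp_term :: "nat \<Rightarrow> nat \<Rightarrow> nat \<Rightarrow> nat \<Rightarrow> nat \<times> nat \<Rightarrow> complex" where
  "psp_term a b c d = (\<lambda>(m, n). inverse (of_nat m) ^ a * inverse (of_nat n) ^ b *
     inverse (of_nat (m + n)) ^ c * inverse (of_nat (m + 2 * n)) ^ d)"

definition psp_zeta :: "nat \<Rightarrow> nat \<Rightarrow> nat \<Rightarrow> nat \<Rightarrow> complex" where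
  "psp_zeta a b c d = zeta2_PSp2 (of_nat a) (of_nat b) (of_nat c) (of_nat d)"

lemma psp_term_has_sum:
  assumes "a \<ge> 1" "b \<ge> 1" "c \<ge> 1" "d \<ge> 1"
  shows "(psp_term a b c d has_sum psp_zeta a b c d) chamber"
proof -
  have "((\<lambda>(m1, m2). 1 / (of_nat m1 powr of_nat a * of_nat m2 powr of_nat b *
             of_nat (m1 + m2) powr of_nat c * of_nat (m1 + 2 * m2) powr of_nat d) :: complex)
         has_sum psp_zeta a b c d) {(m1 :: nat, m2 :: nat). m1 \<ge> 1 \<and> m2 \<ge> 1 \<and> [m1 = 1] (mod 2)}"
    unfolding psp_zeta_def zeta2_PSp2_def by (rule has_sum_infsum[OF zeta2_PSp2_summable[OF assms]])
  moreover have "{(m1 :: nat, m2 :: nat). m1 \<ge> 1 \<and> m2 \<ge> 1 \<and> [m1 = 1] (mod 2)} = chamber"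
    by (auto simp: chamber_def cong_def odd_iff_mod_2_eq_one)
  moreover have "1 / (of_nat m powr of_nat a * of_nat n powr of_nat b *
             of_nat (m + n) powr of_nat c * of_nat (m + 2 * n) powr of_nat d) = psp_term a b c d (m, n)"
    if "(m, n) \<in> chamber" for m n
    using that
    by (simp add: chamber_def psp_term_def powr_nat' divide_inverse power_inverse
        del: of_nat_add of_nat_mult)
  ultimately show ?thesis
    by (subst has_sum_cong[where g = "\<lambda>(m1, m2). 1 / (of_nat m1 powr of_nat a * of_nat m2 powr of_nat b *
             of_nat (m1 + m2) powr of_nat c * of_nat (m1 + 2 * m2) powr of_nat d)"]) auto
qed

text \<open>Used with signs \<open>e\<close>, \<open>e'\<close>, \<open>e''\<close> and with
  \<open>r\<close> equal to 2 or 1, it separates the constant of a region from the zeta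
  summand.\<close>

lemma kernel_scaled:
  assumes "odd x = \<rho>" "x \<notin> {0, t, - t}" "of_int x = e * X" "of_int (t - x) = r * (e' * Y)"
    "of_int (t + x) = r * (e'' * Z)"
  shows "kernel \<rho> p q s t x = inverse r ^ (q + s) *
    (inverse e ^ p * inverse e' ^ q * inverse e'' ^ s * (inverse X ^ p * inverse Y ^ q * inverse Z ^ s))"
  using assms(1,2) unfolding kernel_def assms(3-5)
  by (simp only: simp_thms if_True not_False_eq_True inverse_mult_distrib power_mult_distrib power_add mult_ac)

text \<open>A change of variables: \<open>i\<close> maps the chamber bijectively onto the region
  \<open>S\<close> with inverse \<open>j\<close>, and \<open>F\<close> pulls back to a zeta summand
  times the constant \<open>\<epsilon>\<close>.\<close>

lemma has_sum_reflected:
  assumes "(psp_term a b c d has_sum psp_zeta a b c d) chamber"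
    and "\<And>m n. (m, n) \<in> chamber \<Longrightarrow> i (m, n) \<in> S \<and> j (i (m, n)) = (m, n)"
    and "\<And>t x. (t, x) \<in> S \<Longrightarrow> j (t, x) \<in> chamber \<and> i (j (t, x)) = (t, x)"
    and "\<And>m n. (m, n) \<in> chamber \<Longrightarrow> F (i (m, n)) = \<epsilon> * psp_term a b c d (m, n)"
  shows "(F has_sum \<epsilon> * psp_zeta a b c d) S"
proof -
  have "((\<lambda>z. \<epsilon> * psp_term a b c d z) has_sum \<epsilon> * psp_zeta a b c d) chamber"
    by (rule has_sum_cmult_right[OF assms(1)])
  also have "?this \<longleftrightarrow> ?thesis"
    by (rule has_sum_reindex_bij_witness[of _ j i]) (use assms(2-4) in auto)
  finally show ?thesis .
qed

text \<open>The four regions are disjoint. What they leave out lies on the lines x = 0, x = t, x =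
  -t or violates the parity condition \<open>\<phi>\<close>, and there \<open>F\<close>
  vanishes.\<close>

lemma has_sum_four_regions:
  fixes F :: "int \<times> int \<Rightarrow> complex"
  assumes "(F has_sum V1) {(t, x). t > 0 \<and> \<phi> t x \<and> 0 < x \<and> x < t}"
    and "(F has_sum V2) {(t, x). t > 0 \<and> \<phi> t x \<and> - t < x \<and> x < 0}"
    and "(F has_sum V3) {(t, x). t > 0 \<and> \<phi> t x \<and> t < x}"
    and "(F has_sum V4) {(t, x). t > 0 \<and> \<phi> t x \<and> x < - t}"
    and "\<And>t x. t > 0 \<Longrightarrow> \<not> \<phi> t x \<Longrightarrow> \<psi> t \<Longrightarrow> F (t, x) = 0"
    and "\<And>t x. t > 0 \<Longrightarrow> x \<in> {0, t, - t} \<Longrightarrow> F (t, x) = 0"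
    and "\<And>t x. t > 0 \<Longrightarrow> \<phi> t x \<Longrightarrow> \<psi> t"
  shows "(F has_sum (V1 + V2 + V3 + V4)) ({t. t > 0 \<and> \<psi> t} \<times> UNIV)"
proof -
  let ?R = "{(t, x). t > 0 \<and> \<phi> t x \<and> 0 < x \<and> x < t} \<union> {(t, x). t > 0 \<and> \<phi> t x \<and> - t < x \<and> x < 0} \<union>
    {(t, x). t > 0 \<and> \<phi> t x \<and> t < x} \<union> {(t, x). t > 0 \<and> \<phi> t x \<and> x < - t}"
  have sum: "(F has_sum (V1 + V2 + V3 + V4)) ?R"
    by (intro has_sum_Un_disjoint assms(1-4)) auto
  have zero: "F z = 0" if z: "z \<in> {t. t > 0 \<and> \<psi> t} \<times> UNIV - ?R" for z
  proof -
    obtain t x where tx: "z = (t, x)" by force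
    with z have "t > 0" "\<psi> t" "\<not> \<phi> t x \<or> x \<in> {0, t, - t}" by auto
    thus ?thesis using assms(5,6) tx by blast
  qed
  have sub: "?R \<subseteq> {t. t > 0 \<and> \<psi> t} \<times> UNIV" using assms(7) by auto
  have "(F has_sum (V1 + V2 + V3 + V4)) ?R \<longleftrightarrow>
      (F has_sum (V1 + V2 + V3 + V4)) ({t. t > 0 \<and> \<psi> t} \<times> UNIV)"
  proof (rule has_sum_cong_neutral)
    show "F z = 0" if "z \<in> ?R - {t. t > 0 \<and> \<psi> t} \<times> UNIV" for z
      using that sub by blast
  qed (rule zero, simp, rule refl)
  with sum show ?thesis by simp
qed

lemma has_sum_odd_lines:
  assumes "a \<ge> 1" "b \<ge> 1" "c \<ge> 1" "d \<ge> 1"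
  shows "((\<lambda>(t, x). kernel True a b c t x * inverse (of_int t) ^ d) has_sum
     (inverse 2 ^ (b + c) * psp_zeta a b c d + inverse 2 ^ (b + c) * (-1) ^ a * psp_zeta a c b d +
      inverse 2 ^ (b + c) * (-1) ^ b * psp_zeta d b c a +
      inverse 2 ^ (b + c) * (-1) ^ (a + c) * psp_zeta d c b a))
     ({t. t > 0 \<and> odd t = True} \<times> UNIV)"
    (is "(?F has_sum _) _")
proof (rule has_sum_four_regions[where \<phi> = "\<lambda>t x. odd t \<and> odd x"])
  \<comment> \<open>With t = m + 2n and x = m: t - x = 2n and t + x = 2(m + n), hence the power of
    2.\<close>
  show "(?F has_sum inverse 2 ^ (b + c) * psp_zeta a b c d)
          {(t, x). t > 0 \<and> (odd t \<and> odd x) \<and> 0 < x \<and> x < t}"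
  proof (rule has_sum_reflected[where i = "\<lambda>(m, n). (int (m + 2 * n), int m)"
        and j = "\<lambda>(t, x). (nat x, nat ((t - x) div 2))", OF psp_term_has_sum[OF assms]], goal_cases)
    case (3 m n)
    hence "kernel True a b c (int (m + 2 * n)) (int m) = inverse 2 ^ (b + c) *
      (inverse 1 ^ a * inverse 1 ^ b * inverse 1 ^ c *
       (inverse (of_nat m) ^ a * inverse (of_nat n) ^ b * inverse (of_nat (m + n)) ^ c))"
      by (intro kernel_scaled) (auto simp: chamber_def)
    thus ?case by (simp add: psp_term_def mult_ac)
  qed ((auto simp: chamber_def even_nat_iff Suc_le_eq; presburger)+)
  \<comment> \<open>Now x = -m, so t - x = 2(m + n) and t + x = 2n: \<open>b\<close> and
    \<open>c\<close> trade places.\<close>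
  show "(?F has_sum inverse 2 ^ (b + c) * (-1) ^ a * psp_zeta a c b d)
          {(t, x). t > 0 \<and> (odd t \<and> odd x) \<and> - t < x \<and> x < 0}"
  proof (rule has_sum_reflected[where i = "\<lambda>(m, n). (int (m + 2 * n), - int m)"
        and j = "\<lambda>(t, x). (nat (- x), nat ((t + x) div 2))",
        OF psp_term_has_sum[OF assms(1,3,2,4)]], goal_cases)
    case (3 m n)
    hence "kernel True a b c (int (m + 2 * n)) (- int m) = inverse 2 ^ (b + c) *
      (inverse (-1) ^ a * inverse 1 ^ b * inverse 1 ^ c *
       (inverse (of_nat m) ^ a * inverse (of_nat (m + n)) ^ b * inverse (of_nat n) ^ c))"
      by (intro kernel_scaled) (auto simp: chamber_def)
    thus ?case by (simp add: psp_term_def mult_ac)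
  qed ((auto simp: chamber_def even_nat_iff Suc_le_eq; presburger)+)
  \<comment> \<open>Now t = m and x = m + 2n: \<open>a\<close> and \<open>d\<close> trade places,
    and t - x = -2n gives the sign.\<close>
  show "(?F has_sum inverse 2 ^ (b + c) * (-1) ^ b * psp_zeta d b c a)
          {(t, x). t > 0 \<and> (odd t \<and> odd x) \<and> t < x}"
  proof (rule has_sum_reflected[where i = "\<lambda>(m, n). (int m, int (m + 2 * n))"
        and j = "\<lambda>(t, x). (nat t, nat ((x - t) div 2))",
        OF psp_term_has_sum[OF assms(4,2,3,1)]], goal_cases)
    case (3 m n)
    hence "kernel True a b c (int m) (int (m + 2 * n)) = inverse 2 ^ (b + c) *
      (inverse 1 ^ a * inverse (-1) ^ b * inverse 1 ^ c *
       (inverse (of_nat (m + 2 * n)) ^ a * inverse (of_nat n) ^ b * inverse (of_nat (m + n)) ^ c))"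
      by (intro kernel_scaled) (auto simp: chamber_def)
    thus ?case by (simp add: psp_term_def mult_ac)
  qed ((auto simp: chamber_def even_nat_iff Suc_le_eq; presburger)+)
  \<comment> \<open>Both exchanges occur: t = m and x = -(m + 2n), with signs from x and from t + x
    = -2n.\<close>
  show "(?F has_sum inverse 2 ^ (b + c) * (-1) ^ (a + c) * psp_zeta d c b a)
          {(t, x). t > 0 \<and> (odd t \<and> odd x) \<and> x < - t}"
  proof (rule has_sum_reflected[where i = "\<lambda>(m, n). (int m, - int (m + 2 * n))"
        and j = "\<lambda>(t, x). (nat t, nat ((- x - t) div 2))",
        OF psp_term_has_sum[OF assms(4,3,2,1)]], goal_cases)
    case (3 m n)
    hence "kernel True a b c (int m) (- int (m + 2 * n)) = inverse 2 ^ (b + c) *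
      (inverse (-1) ^ a * inverse 1 ^ b * inverse (-1) ^ c *
       (inverse (of_nat (m + 2 * n)) ^ a * inverse (of_nat (m + n)) ^ b * inverse (of_nat n) ^ c))"
      by (intro kernel_scaled) (auto simp: chamber_def)
    thus ?case by (simp add: psp_term_def power_add mult_ac)
  qed ((auto simp: chamber_def even_nat_iff Suc_le_eq; presburger)+)
qed (auto simp: kernel_def)

text \<open>With t = m + n and x = n one has t - x = m and t + x = m + 2n. Since m is odd, x has the
  parity opposite to t, whence the argument \<open>even t\<close>.\<close>

lemma has_sum_mixed_parity_lines:
  assumes "a \<ge> 1" "b \<ge> 1" "c \<ge> 1" "d \<ge> 1"
  shows "((\<lambda>(t, x). kernel (even t) b a d t x * inverse (of_int t) ^ c) has_sum
     (1 * psp_zeta a b c d + (-1) ^ b * psp_zeta d b c a +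
      (-1) ^ a * psp_zeta a c b d + (-1) ^ (b + d) * psp_zeta d c b a))
     ({t. t > 0 \<and> True} \<times> UNIV)"
    (is "(?F has_sum _) _")
proof (rule has_sum_four_regions[where \<phi> = "\<lambda>t x. odd (t + x)"])
  show "(?F has_sum 1 * psp_zeta a b c d) {(t, x). t > 0 \<and> odd (t + x) \<and> 0 < x \<and> x < t}"
  proof (rule has_sum_reflected[where i = "\<lambda>(m, n). (int (m + n), int n)"
        and j = "\<lambda>(t, x). (nat (t - x), nat x)", OF psp_term_has_sum[OF assms]], goal_cases)
    case (3 m n)
    hence "kernel (even (int (m + n))) b a d (int (m + n)) (int n) = inverse 1 ^ (a + d) *
      (inverse 1 ^ b * inverse 1 ^ a * inverse 1 ^ d *
       (inverse (of_nat n) ^ b * inverse (of_nat m) ^ a * inverse (of_nat (m + 2 * n)) ^ d))"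
      by (intro kernel_scaled) (auto simp: chamber_def)
    thus ?case by (simp add: psp_term_def mult_ac)
  qed ((auto simp: chamber_def even_nat_iff Suc_le_eq; presburger)+)
  show "(?F has_sum (-1) ^ b * psp_zeta d b c a) {(t, x). t > 0 \<and> odd (t + x) \<and> - t < x \<and> x < 0}"
  proof (rule has_sum_reflected[where i = "\<lambda>(m, n). (int (m + n), - int n)"
        and j = "\<lambda>(t, x). (nat (t + x), nat (- x))", OF psp_term_has_sum[OF assms(4,2,3,1)]], goal_cases)
    case (3 m n)
    hence "kernel (even (int (m + n))) b a d (int (m + n)) (- int n) = inverse 1 ^ (a + d) *
      (inverse (-1) ^ b * inverse 1 ^ a * inverse 1 ^ d *
       (inverse (of_nat n) ^ b * inverse (of_nat (m + 2 * n)) ^ a * inverse (of_nat m) ^ d))"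
      by (intro kernel_scaled) (auto simp: chamber_def)
    thus ?case by (simp add: psp_term_def mult_ac)
  qed ((auto simp: chamber_def even_nat_iff Suc_le_eq; presburger)+)
  show "(?F has_sum (-1) ^ a * psp_zeta a c b d) {(t, x). t > 0 \<and> odd (t + x) \<and> t < x}"
  proof (rule has_sum_reflected[where i = "\<lambda>(m, n). (int n, int (m + n))"
        and j = "\<lambda>(t, x). (nat (x - t), nat t)", OF psp_term_has_sum[OF assms(1,3,2,4)]], goal_cases)
    case (3 m n)
    hence "kernel (even (int n)) b a d (int n) (int (m + n)) = inverse 1 ^ (a + d) *
      (inverse 1 ^ b * inverse (-1) ^ a * inverse 1 ^ d *
       (inverse (of_nat (m + n)) ^ b * inverse (of_nat m) ^ a * inverse (of_nat (m + 2 * n)) ^ d))"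
      by (intro kernel_scaled) (auto simp: chamber_def)
    thus ?case by (simp add: psp_term_def mult_ac)
  qed ((auto simp: chamber_def even_nat_iff Suc_le_eq; presburger)+)
  \<comment> \<open>Here t = n and x = -(m + n), so t + x = -m: the signs come from the exponents
    \<open>b\<close> and \<open>d\<close>, not from \<open>a\<close> and \<open>c\<close> as on the
    odd lines.\<close>
  show "(?F has_sum (-1) ^ (b + d) * psp_zeta d c b a) {(t, x). t > 0 \<and> odd (t + x) \<and> x < - t}"
  proof (rule has_sum_reflected[where i = "\<lambda>(m, n). (int n, - int (m + n))"
        and j = "\<lambda>(t, x). (nat (- x - t), nat t)", OF psp_term_has_sum[OF assms(4,3,2,1)]], goal_cases)
    case (3 m n)
    hence "kernel (even (int n)) b a d (int n) (- int (m + n)) = inverse 1 ^ (a + d) *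
      (inverse (-1) ^ b * inverse 1 ^ a * inverse (-1) ^ d *
       (inverse (of_nat (m + n)) ^ b * inverse (of_nat (m + 2 * n)) ^ a * inverse (of_nat m) ^ d))"
      by (intro kernel_scaled) (auto simp: chamber_def)
    thus ?case by (simp add: psp_term_def power_add mult_ac)
  qed ((auto simp: chamber_def even_nat_iff Suc_le_eq; presburger)+)
qed (auto simp: kernel_def)

section \<open>Comparison of the two full sums\<close>

lemma odd_lines_in_zeta_algebra:
  assumes "a \<ge> 1" "b \<ge> 1" "c \<ge> 1" "d \<ge> 1"
  shows "psp_zeta a b c d + (-1) ^ a * psp_zeta a c b d + (-1) ^ b * psp_zeta d b c a +
           (-1) ^ (a + c) * psp_zeta d c b a \<in> zeta_algebra" (is "?V \<in> _")
proof -
  let ?W = "inverse 2 ^ (b + c) * psp_zeta a b c d + inverse 2 ^ (b + c) * (-1) ^ a * psp_zeta a c b d +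
      inverse 2 ^ (b + c) * (-1) ^ b * psp_zeta d b c a +
      inverse 2 ^ (b + c) * (-1) ^ (a + c) * psp_zeta d c b a"
  have "?W \<in> zeta_algebra"
    by (rule kernel_double_sum_in_zeta_algebra[OF assms(1,2,4) has_sum_odd_lines[OF assms]])
  hence "2 ^ (b + c) * ?W \<in> zeta_algebra"
    by (rule zeta_algebra_mult[OF zeta_algebra_Rats, rotated]) auto
  also have "?W = inverse (2 ^ (b + c)) * ?V"
    by (simp only: power_inverse distrib_left mult.assoc)
  also have "2 ^ (b + c) * (inverse (2 ^ (b + c)) * ?V) = ?V"
    by (simp flip: mult.assoc)
  finally show ?thesis .
qed

text \<open>The polynomial for the inner sum depends on the parity of t, so odd and even t are
  summed separately.\<close>

lemma mixed_parity_lines_in_zeta_algebra: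
  assumes "a \<ge> 1" "b \<ge> 1" "c \<ge> 1" "d \<ge> 1"
  shows "psp_zeta a b c d + (-1) ^ b * psp_zeta d b c a + (-1) ^ a * psp_zeta a c b d +
           (-1) ^ (b + d) * psp_zeta d c b a \<in> zeta_algebra" (is "?V \<in> _")
proof -
  let ?F = "\<lambda>(t, x). kernel (even t) b a d t x * inverse (of_int t) ^ c"
  let ?A = "\<lambda>\<sigma>. {t::int. t > 0 \<and> odd t = \<sigma>} \<times> (UNIV :: int set)"
  have V: "(?F has_sum ?V) ({t. t > 0} \<times> UNIV)"
    using has_sum_mixed_parity_lines[OF assms] by simp
  have lines: "\<exists>W. W \<in> zeta_algebra \<and> (?F has_sum W) (?A \<sigma>)" for \<sigma>
  proof -
    have "?F summable_on ?A \<sigma>"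
      using has_sum_imp_summable[OF V] by (rule summable_on_subset_banach) auto
    then obtain W where W: "(?F has_sum W) (?A \<sigma>)" by (auto simp: summable_on_def)
    also have "?this \<longleftrightarrow>
      ((\<lambda>(t, x). kernel (\<not> \<sigma>) b a d t x * inverse (of_int t) ^ c) has_sum W) (?A \<sigma>)"
      by (rule has_sum_cong) auto
    finally have "W \<in> zeta_algebra"
      by (rule kernel_double_sum_in_zeta_algebra[OF assms(2,1,3)])
    with W show ?thesis by blast
  qed
  obtain W1 where W1: "W1 \<in> zeta_algebra" "(?F has_sum W1) (?A True)" using lines[of True] by blast
  obtain W2 where W2: "W2 \<in> zeta_algebra" "(?F has_sum W2) (?A False)" using lines[of False] by blast
  have "(?F has_sum (W1 + W2)) (?A True \<union> ?A False)"
    by (rule has_sum_Un_disjoint[OF W1(2) W2(2)]) auto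
  also have "?A True \<union> ?A False = {t. t > 0} \<times> UNIV" by auto
  finally have "?V = W1 + W2" by (rule has_sum_unique[OF V])
  thus ?thesis using zeta_algebra_add[OF W1(1) W2(1)] by simp
qed

lemma psp_zeta_in_zeta_algebra:
  assumes "a \<ge> 1" "b \<ge> 1" "c \<ge> 1" "d \<ge> 1" and odd: "odd (a + b + c + d)"
  shows "psp_zeta a b c d \<in> zeta_algebra"
proof -
  have alg: "(u + v + w + p * z) - (u + w + v + q * z) = (p - q) * z" for u v w p q z :: complex
    by (simp add: algebra_simps)
  \<comment> \<open>The reversed arguments \<open>d\<close>, \<open>c\<close>, \<open>b\<close>,
    \<open>a\<close> make \<open>psp_zeta a b c d\<close> the last term of both relations, the only
    one to survive in the difference.\<close>
  have "((-1) ^ (d + b) - (-1) ^ (c + a)) * psp_zeta a b c d \<in> zeta_algebra"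
    using zeta_algebra_diff[OF odd_lines_in_zeta_algebra[OF assms(4,3,2,1)]
        mixed_parity_lines_in_zeta_algebra[OF assms(4,3,2,1)]]
    by (simp only: alg)
  hence *: "inverse ((-1) ^ (d + b) - (-1) ^ (c + a)) *
      (((-1) ^ (d + b) - (-1) ^ (c + a)) * psp_zeta a b c d) \<in> zeta_algebra"
    by (rule zeta_algebra_mult[OF zeta_algebra_Rats, rotated]) auto
  \<comment> \<open>As \<open>a + b + c + d\<close> is odd, the two exponents have opposite parity,
    so the factor is 2 or -2.\<close>
  have "(-1) ^ (d + b) - (-1) ^ (c + a) \<noteq> (0 :: complex)"
    using odd by (cases "even (d + b)"; cases "even (c + a)") auto
  with * show ?thesis by (simp flip: mult.assoc)
qed

theorem theorem6p3:
  fixes a b c d :: nat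
  assumes "a \<ge> 1" "b \<ge> 1" "c \<ge> 1" "d \<ge> 1"
    and "odd (a + b + c + d)"
  shows "\<exists>p :: rat_mpoly. mpoly_vars p \<subseteq> {j. j \<ge> 1} \<and>
           zeta2_PSp2 (of_nat a) (of_nat b) (of_nat c) (of_nat d) =
             mpoly_eval (\<lambda>j. riemann_zeta (of_nat (j + 1))) p"
  using psp_zeta_in_zeta_algebra[OF assms] unfolding psp_zeta_def zeta_algebra_def by blast

end
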